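(* Let $\mathcal T^h$ be a Voronoi mesh for $\Omega$ with $h>0$, let $\kappa>0$, and let $W:\mathbb R^d\to\mathbb R$ satisfy $W(x)=W(-x)\ge 0$, $W\in C^1(\mathbb R^d\setminus\{0\})$, and $W$ Lipschitz. Let $\rho\in\mathcal P(\mathcal T^h)$ be given. The following statements are equivalent: (i) $\rho$ is a stationary state of the Scharfetter--Gummel scheme, i.e. $\sum_{L\sim K}\tau_{KL}\,\theta_\kappa(\rho_K,\rho_L;d_{KL}q_{KL}[\rho])=0$ for all $K\in\mathcal T^h$; (ii) $\rho$ solves the Kirkwood--Monroe fixed point equation $$\rho_K=\frac{\exp\big(-\kappa^{-1}\sum_J|J|\rho_JW(x_K-x_J)\big)}{Z^h(\rho)}\quad\text{for any }K\in\mathcal T^h,$$ where $Z^h(\rho)=\sum_{\tilde K}|\tilde K|\exp\big(-\kappa^{-1}\sum_J|J|\rho_JW(x_{\tilde K}-x_J)\big)$; (iii) $\rho$ is a critical point of the free energy functional $\mathcal F^h$ on $\mathcal P(\mathcal T^h)$; (iv) $\rho$ is without dissipation, i.e. $\mathcal D^h(\rho)=0$.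
   Context: Mesh. $\Omega\subset\mathbb R^d$ is a bounded (connected) domain with smooth boundary. A Voronoi mesh $\mathcal T^h$ for $\Omega$ is a finite family of cells of a Voronoi tesselation that covers $\Omega$, such that each cell $K$ is compact, $K\cap\Omega\neq\emptyset$ and $\mathrm{diam}(K)\le h$. The generator of $K$ is $x_K\in K$, and $d_{KL}=|x_K-x_L|$. Two distinct cells $K,L\in\mathcal T^h$ are neighbors, $L\sim K$, if they share a face $K|L=K\cap L$ of positive $(d-1)$-dimensional area $|K|L|$; $\tau_{KL}=|K|L|/d_{KL}$. $|K|$ is the volume of $K$. $\mathcal P(\mathcal T^h)=\{\{\rho_K\}_{K\in\mathcal T^h}:\rho_K\ge 0\ \forall K,\ \sum_K|K|\rho_K=1\}$. For $\rho\in\mathcal P(\mathcal T^h)$: $q_{KL}[\rho]=\sum_{J}|J|\rho_J\frac{W(x_K-x_J)-W(x_L-x_J)}{d_{KL}}$. For $a,b\ge0$, $v\in\mathbb R$: $\theta_\kappa(a,b;v)=v\,\frac{ae^{v/2\kappa}-be^{-v/2\kappa}}{e^{v/2\kappa}-e^{-v/2\kappa}}$ if $v\neq0$, and $\theta_\kappa(a,b;0)=\kappa(a-b)$. (Thus $\tau_{KL}\theta_\kappa(\rho_K,\rho_L;d_{KL}q_{KL}[\rho])$ is the Scharfetter--Gummel flux from $K$ to $L$ for a time-independent density.) Free energy: $\mathcal F^h(\rho)=\kappa\sum_K|K|\rho_K\log\rho_K+\frac12\sum_{K,L}|K||L|W(x_K-x_L)\rho_K\rho_L$ ($0\log 0=0$).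 Critical point of $\mathcal F^h$ on $\mathcal P(\mathcal T^h)$: $\rho_K>0$ for all $K$ and $\lim_{\varepsilon\to0}\varepsilon^{-1}(\mathcal F^h(\rho+\varepsilon s)-\mathcal F^h(\rho))=0$ for every $s:\mathcal T^h\to\mathbb R$ with $\sum_K|K|s_K=0$. Dissipation: $\mathcal D^h(\rho)=\frac12\sum_K\sum_{L\sim K}\kappa\,\tau_{KL}\,\alpha_\kappa(\rho_K,\rho_L;d_{KL}q_{KL}[\rho])$, where for $a,b>0$, $\alpha_\kappa(a,b;v)=\big(\log(ae^{v/2\kappa})-\log(be^{-v/2\kappa})\big)\theta_\kappa(a,b;v)\ge0$; by convention $\alpha_\kappa(a,b;v)=+\infty$ if exactly one of $a,b$ is zero and $\alpha_\kappa(0,0;v)=0$. *)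

theory Defs
  imports "HOL-Analysis.Analysis"
begin

section \<open>Regularity\<close>

text \<open>Meaningful for open \<open>S\<close>: all partial derivatives up to order \<open>k\<close> exist as
  directional derivatives of Frechet derivatives, and those of order \<open>k\<close> are continuous.\<close>

primrec Ck_on :: "nat \<Rightarrow> ('a::euclidean_space \<Rightarrow> real) \<Rightarrow> 'a set \<Rightarrow> bool" where
  "Ck_on 0 f S \<longleftrightarrow> continuous_on S f"
| "Ck_on (Suc k) f S \<longleftrightarrow> (\<forall>x\<in>S. f differentiable (at x)) \<and>
     (\<forall>i\<in>Basis. Ck_on k (\<lambda>x. frechet_derivative f (at x) i) S)"

definition Cinf_on :: "('a::euclidean_space \<Rightarrow> real) \<Rightarrow> 'a set \<Rightarrow> bool" where
  "Cinf_on f S \<longleftrightarrow> (\<forall>k. Ck_on k f S)"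

text \<open>Near each of its boundary points the set is a strict sublevel set of a smooth function
  whose derivative does not vanish there.\<close>

definition smooth_boundary :: "'a::euclidean_space set \<Rightarrow> bool" where
  "smooth_boundary \<Omega> \<longleftrightarrow> (\<forall>p\<in>frontier \<Omega>. \<exists>U \<phi>. open U \<and> p \<in> U \<and> Cinf_on \<phi> U \<and>
     (\<exists>v. frechet_derivative \<phi> (at p) v \<noteq> 0) \<and> \<phi> p = 0 \<and> \<Omega> \<inter> U = {y\<in>U. \<phi> y < 0})"

definition bounded_smooth_domain :: "'a::euclidean_space set \<Rightarrow> bool" where
  "bounded_smooth_domain \<Omega> \<longleftrightarrow>
     open \<Omega> \<and> connected \<Omega> \<and> \<Omega> \<noteq> {} \<and> bounded \<Omega> \<and> smooth_boundary \<Omega>"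


section \<open>Hausdorff measure\<close>

text \<open>The factor \<open>unit_ball_vol s / 2 ^ s\<close> makes the \<open>s\<close>-dimensional Hausdorff measure agree with
  \<open>s\<close>-dimensional Lebesgue measure on \<open>s\<close>-dimensional planes. The empty set is treated separately
  so that \<open>s = 0\<close> gives the counting measure (\<open>0 ^ 0 = 1\<close>).\<close>

definition hausdorff_gauge :: "nat \<Rightarrow> 'a::euclidean_space set \<Rightarrow> ennreal" where
  "hausdorff_gauge s U =
     (if U = {} then 0 else ennreal (unit_ball_vol (real s) * (diameter U / 2) ^ s))"

definition hausdorff_premeasure :: "nat \<Rightarrow> real \<Rightarrow> 'a::euclidean_space set \<Rightarrow> ennreal" where
  "hausdorff_premeasure s \<delta> A =
     Inf {(\<Sum>i. hausdorff_gauge s (U i)) | U :: nat \<Rightarrow> 'a set.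
            A \<subseteq> (\<Union>i. U i) \<and> (\<forall>i. bounded (U i) \<and> diameter (U i) \<le> \<delta>)}"

definition hausdorff_measure :: "nat \<Rightarrow> 'a::euclidean_space set \<Rightarrow> ennreal" where
  "hausdorff_measure s A = (SUP \<delta>\<in>{0<..}. hausdorff_premeasure s \<delta> A)"


section \<open>Voronoi meshes\<close>

definition voronoi_cell :: "'a::euclidean_space set \<Rightarrow> 'a \<Rightarrow> 'a set" where
  "voronoi_cell X p = {y. \<forall>q\<in>X. dist y p \<le> dist y q}"

definition locally_finite_points :: "'a::euclidean_space set \<Rightarrow> bool" where
  "locally_finite_points X \<longleftrightarrow> (\<forall>c r. finite (X \<inter> cball c r))"

text \<open>\<open>T\<close> is the finite set of cells and \<open>x K\<close> the generator of the cell \<open>K\<close>. The tessellation may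
  have further (possibly infinitely many or unbounded) cells outside \<open>T\<close>.\<close>

definition voronoi_mesh ::
  "'a::euclidean_space set \<Rightarrow> real \<Rightarrow> 'a set set \<Rightarrow> ('a set \<Rightarrow> 'a) \<Rightarrow> bool" where
  "voronoi_mesh \<Omega> h T x \<longleftrightarrow>
     (\<exists>X. locally_finite_points X \<and> (\<forall>K\<in>T. x K \<in> X \<and> K = voronoi_cell X (x K))) \<and>
     finite T \<and> \<Omega> \<subseteq> \<Union>T \<and>
     (\<forall>K\<in>T. compact K \<and> K \<inter> \<Omega> \<noteq> {} \<and> diameter K \<le> h)"

abbreviation vol :: "'a::euclidean_space set \<Rightarrow> real" where
  "vol K \<equiv> measure lebesgue K"

abbreviation face_measure :: "'a::euclidean_space set \<Rightarrow> 'a set \<Rightarrow> ennreal" where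
  "face_measure K L \<equiv> hausdorff_measure (DIM('a) - 1) (K \<inter> L)"

definition neighbors :: "'a::euclidean_space set set \<Rightarrow> 'a set \<Rightarrow> 'a set set" where
  "neighbors T K = {L\<in>T. L \<noteq> K \<and> face_measure K L > 0}"

definition transmission :: "('a::euclidean_space set \<Rightarrow> 'a) \<Rightarrow> 'a set \<Rightarrow> 'a set \<Rightarrow> real" where
  "transmission x K L = enn2real (face_measure K L) / dist (x K) (x L)"

text \<open>Densities on the mesh are functions on all sets of which only the values on \<open>T\<close> matter.\<close>

definition mesh_prob :: "'a::euclidean_space set set \<Rightarrow> ('a set \<Rightarrow> real) set" where
  "mesh_prob T = {\<rho>. (\<forall>K\<in>T. \<rho> K \<ge> 0) \<and> (\<Sum>K\<in>T. vol K * \<rho> K) = 1}"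


section \<open>The Scharfetter--Gummel scheme\<close>

definition drift :: "('a::euclidean_space \<Rightarrow> real) \<Rightarrow> 'a set set \<Rightarrow> ('a set \<Rightarrow> 'a) \<Rightarrow>
    ('a set \<Rightarrow> real) \<Rightarrow> 'a set \<Rightarrow> 'a set \<Rightarrow> real" where
  "drift W T x \<rho> K L =
     (\<Sum>J\<in>T. vol J * \<rho> J * ((W (x K - x J) - W (x L - x J)) / dist (x K) (x L)))"

definition theta :: "real \<Rightarrow> real \<Rightarrow> real \<Rightarrow> real \<Rightarrow> real" where
  "theta \<kappa> a b v =
     (if v = 0 then \<kappa> * (a - b)
      else v * ((a * exp (v / (2 * \<kappa>)) - b * exp (- v / (2 * \<kappa>))) /
                (exp (v / (2 * \<kappa>)) - exp (- v / (2 * \<kappa>)))))"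

definition stationary_SG :: "real \<Rightarrow> ('a::euclidean_space \<Rightarrow> real) \<Rightarrow> 'a set set \<Rightarrow>
    ('a set \<Rightarrow> 'a) \<Rightarrow> ('a set \<Rightarrow> real) \<Rightarrow> bool" where
  "stationary_SG \<kappa> W T x \<rho> \<longleftrightarrow>
     (\<forall>K\<in>T. (\<Sum>L\<in>neighbors T K.
        transmission x K L * theta \<kappa> (\<rho> K) (\<rho> L) (dist (x K) (x L) * drift W T x \<rho> K L)) = 0)"


section \<open>The Kirkwood--Monroe equation\<close>

definition gibbs_weight :: "real \<Rightarrow> ('a::euclidean_space \<Rightarrow> real) \<Rightarrow> 'a set set \<Rightarrow>
    ('a set \<Rightarrow> 'a) \<Rightarrow> ('a set \<Rightarrow> real) \<Rightarrow> 'a set \<Rightarrow> real" where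
  "gibbs_weight \<kappa> W T x \<rho> K = exp (- (1 / \<kappa>) * (\<Sum>J\<in>T. vol J * \<rho> J * W (x K - x J)))"

definition partition_function :: "real \<Rightarrow> ('a::euclidean_space \<Rightarrow> real) \<Rightarrow> 'a set set \<Rightarrow>
    ('a set \<Rightarrow> 'a) \<Rightarrow> ('a set \<Rightarrow> real) \<Rightarrow> real" where
  "partition_function \<kappa> W T x \<rho> = (\<Sum>K\<in>T. vol K * gibbs_weight \<kappa> W T x \<rho> K)"

definition kirkwood_monroe :: "real \<Rightarrow> ('a::euclidean_space \<Rightarrow> real) \<Rightarrow> 'a set set \<Rightarrow>
    ('a set \<Rightarrow> 'a) \<Rightarrow> ('a set \<Rightarrow> real) \<Rightarrow> bool" where
  "kirkwood_monroe \<kappa> W T x \<rho> \<longleftrightarrow>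
     (\<forall>K\<in>T. \<rho> K = gibbs_weight \<kappa> W T x \<rho> K / partition_function \<kappa> W T x \<rho>)"


section \<open>Free energy and dissipation\<close>

definition free_energy :: "real \<Rightarrow> ('a::euclidean_space \<Rightarrow> real) \<Rightarrow> 'a set set \<Rightarrow>
    ('a set \<Rightarrow> 'a) \<Rightarrow> ('a set \<Rightarrow> real) \<Rightarrow> real" where
  "free_energy \<kappa> W T x \<rho> =
     \<kappa> * (\<Sum>K\<in>T. vol K * (\<rho> K * ln (\<rho> K))) +
     1 / 2 * (\<Sum>K\<in>T. \<Sum>L\<in>T. vol K * vol L * W (x K - x L) * \<rho> K * \<rho> L)"

definition critical_point :: "real \<Rightarrow> ('a::euclidean_space \<Rightarrow> real) \<Rightarrow> 'a set set \<Rightarrow>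
    ('a set \<Rightarrow> 'a) \<Rightarrow> ('a set \<Rightarrow> real) \<Rightarrow> bool" where
  "critical_point \<kappa> W T x \<rho> \<longleftrightarrow>
     (\<forall>K\<in>T. \<rho> K > 0) \<and>
     (\<forall>s. (\<Sum>K\<in>T. vol K * s K) = 0 \<longrightarrow>
        ((\<lambda>\<epsilon>. (free_energy \<kappa> W T x (\<lambda>K. \<rho> K + \<epsilon> * s K) - free_energy \<kappa> W T x \<rho>) / \<epsilon>)
           \<longlongrightarrow> 0) (at 0))"

text \<open>Only used for \<open>a, b \<ge> 0\<close>.\<close>

definition alpha :: "real \<Rightarrow> real \<Rightarrow> real \<Rightarrow> real \<Rightarrow> ereal" where
  "alpha \<kappa> a b v =
     (if a > 0 \<and> b > 0 then
        ereal ((ln (a * exp (v / (2 * \<kappa>))) - ln (b * exp (- v / (2 * \<kappa>)))) * theta \<kappa> a b v)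
      else if a = 0 \<and> b = 0 then 0 else \<infinity>)"

definition dissipation :: "real \<Rightarrow> ('a::euclidean_space \<Rightarrow> real) \<Rightarrow> 'a set set \<Rightarrow>
    ('a set \<Rightarrow> 'a) \<Rightarrow> ('a set \<Rightarrow> real) \<Rightarrow> ereal" where
  "dissipation \<kappa> W T x \<rho> =
     ereal (1 / 2) * (\<Sum>K\<in>T. \<Sum>L\<in>neighbors T K. ereal (\<kappa> * transmission x K L) *
        alpha \<kappa> (\<rho> K) (\<rho> L) (dist (x K) (x L) * drift W T x \<rho> K L))"

end

theory Submission
  imports Defs
begin

text \<open>Put \<open>\<phi>\<^sub>K = \<Sum>\<^sub>J |J| \<rho>\<^sub>J W (x\<^sub>K - x\<^sub>J)\<close> and \<open>u\<^sub>K = \<rho>\<^sub>K exp (\<phi>\<^sub>K / \<kappa>)\<close>. Each of the four conditions says that \<open>u\<close> is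
  constant on the mesh. For the Kirkwood--Monroe equation this is normalisation, and the first
  variation of the free energy is \<open>\<kappa> \<Sum>\<^sub>K |K| s\<^sub>K ln u\<^sub>K\<close>. The flux is a positive multiple of
  \<open>u\<^sub>K - u\<^sub>L\<close>, so a stationary \<open>u\<close> is harmonic on the neighbour graph, and the dissipation vanishes
  iff \<open>u\<close> agrees on neighbours. In both cases \<open>u\<close> is constant because the neighbour graph is
  connected and all transmission coefficients are positive and finite; these are the geometric facts
  that need the Hausdorff measure of faces.\<close>

section \<open>Hausdorff measure of convex sets and hyperplanes\<close>

text \<open>The premeasure is an infimum over sequences, so a finite cover is padded with empty
  sets. \<open>hausdorff_gauge\<close> assigns these 0 even for \<open>s = 0\<close>, which keeps
  the series equal to the finite sum.\<close>

lemma hausdorff_premeasure_le_sum: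
  assumes "finite I" "S \<subseteq> (\<Union>i\<in>I. U i)" "\<And>i. i \<in> I \<Longrightarrow> bounded (U i) \<and> diameter (U i) \<le> \<delta>" "0 \<le> \<delta>"
  shows "hausdorff_premeasure s \<delta> S \<le> (\<Sum>i\<in>I. hausdorff_gauge s (U i))"
proof -
  obtain g where g: "bij_betw g {..<card I} I"
    using ex_bij_betw_nat_finite[OF assms(1)] by (auto simp: atLeast0LessThan)
  define V where "V n = (if n < card I then U (g n) else {})" for n
  have "(\<Sum>n. hausdorff_gauge s (V n)) = (\<Sum>n<card I. hausdorff_gauge s (V n))"
    by (rule suminf_finite) (auto simp: V_def hausdorff_gauge_def)
  also have "\<dots> = (\<Sum>n<card I. hausdorff_gauge s (U (g n)))"
    by (simp add: V_def)
  also have "\<dots> = (\<Sum>i\<in>I. hausdorff_gauge s (U i))"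
    using g by (rule sum.reindex_bij_betw)
  finally have sum: "(\<Sum>n. hausdorff_gauge s (V n)) = (\<Sum>i\<in>I. hausdorff_gauge s (U i))" .
  have "S \<subseteq> (\<Union>n. V n)"
  proof
    fix y assume "y \<in> S"
    then obtain i where i: "i \<in> I" "y \<in> U i" using assms(2) by blast
    then have "i \<in> g ` {..<card I}" using g by (simp add: bij_betw_def)
    then obtain n where "n < card I" "g n = i" by blast
    then show "y \<in> (\<Union>n. V n)" using i by (auto simp: V_def)
  qed
  moreover have "bounded (V n) \<and> diameter (V n) \<le> \<delta>" for n
    using assms(3)[of "g n"] assms(4) g by (auto simp: V_def bij_betw_def)
  ultimately show ?thesis
    unfolding hausdorff_premeasure_def sum[symmetric] by (intro Inf_lower) blast
qed

text \<open>The hyperplane is a Lipschitz graph over the coordinates other than some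
  \<open>e\<close> with \<open>n \<bullet> e\<close> nonzero. Cutting these d - 1 coordinates into N
  intervals each gives N^(d-1) pieces of diameter of order 1/N, so the gauge sum has a bound
  independent of the scale.\<close>

lemma hausdorff_measure_hyperplane_finite:
  fixes S :: "'a::euclidean_space set"
  assumes "bounded S" "n \<noteq> 0" "S \<subseteq> {y. n \<bullet> y = c}"
  shows "hausdorff_measure (DIM('a) - 1) S < \<infinity>"
proof -
  obtain e where e: "e \<in> Basis" "n \<bullet> e \<noteq> 0"
    using assms(2) euclidean_all_zero_iff by blast
  define B where "B = Basis - {e}"
  have B: "finite B" "card B = DIM('a) - 1" "Basis = insert e B" "e \<notin> B"
    using e by (auto simp: B_def)
  \<comment> \<open>Solving \<open>n \<bullet> (y - z) = 0\<close> for the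
    \<open>e\<close>-coordinate bounds the l1 norm of \<open>y - z\<close> by \<open>M\<close> times
    the largest coordinate difference over \<open>B\<close>.\<close>
  define M where "M = (\<Sum>b\<in>B. 1 + \<bar>n \<bullet> b\<bar> / \<bar>n \<bullet> e\<bar>)"
  have M: "M \<ge> 0" unfolding M_def by (intro sum_nonneg) auto
  have dist: "dist y z \<le> M * \<eta>"
    if "y \<in> S" "z \<in> S" and small: "\<And>b. b \<in> B \<Longrightarrow> \<bar>(y - z) \<bullet> b\<bar> \<le> \<eta>" for y z \<eta>
  proof -
    have "0 = n \<bullet> (y - z)" using that(1,2) assms(3) by (auto simp: inner_diff_right)
    also have "\<dots> = (\<Sum>b\<in>Basis. (n \<bullet> b) * ((y - z) \<bullet> b))" by (rule euclidean_inner)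
    also have "\<dots> = (n \<bullet> e) * ((y - z) \<bullet> e) + (\<Sum>b\<in>B. (n \<bullet> b) * ((y - z) \<bullet> b))"
      using B(1,4) by (subst B(3)) simp
    finally have "\<bar>n \<bullet> e\<bar> * \<bar>(y - z) \<bullet> e\<bar> = \<bar>\<Sum>b\<in>B. (n \<bullet> b) * ((y - z) \<bullet> b)\<bar>"
      by (simp add: abs_mult[symmetric])
    also have "\<dots> \<le> (\<Sum>b\<in>B. \<bar>n \<bullet> b\<bar> * \<bar>(y - z) \<bullet> b\<bar>)"
      unfolding abs_mult[symmetric] by (rule sum_abs)
    finally have "\<bar>(y - z) \<bullet> e\<bar> \<le> (\<Sum>b\<in>B. \<bar>n \<bullet> b\<bar> * \<bar>(y - z) \<bullet> b\<bar>) / \<bar>n \<bullet> e\<bar>"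
      using e by (simp add: field_simps)
    also have "\<dots> = (\<Sum>b\<in>B. \<bar>n \<bullet> b\<bar> / \<bar>n \<bullet> e\<bar> * \<bar>(y - z) \<bullet> b\<bar>)"
      by (simp add: sum_divide_distrib)
    finally have "(\<Sum>b\<in>Basis. \<bar>(y - z) \<bullet> b\<bar>)
        \<le> (\<Sum>b\<in>B. (1 + \<bar>n \<bullet> b\<bar> / \<bar>n \<bullet> e\<bar>) * \<bar>(y - z) \<bullet> b\<bar>)"
      using B(1,4) by (subst B(3)) (simp add: algebra_simps sum.distrib)
    also have "\<dots> \<le> (\<Sum>b\<in>B. (1 + \<bar>n \<bullet> b\<bar> / \<bar>n \<bullet> e\<bar>) * \<eta>)"
      using small by (intro sum_mono mult_left_mono) auto
    finally show ?thesis
      using norm_le_l1[of "y - z"] by (simp add: M_def dist_norm sum_distrib_right)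
  qed
  obtain R where R: "R > 0" "\<And>y. y \<in> S \<Longrightarrow> norm y < R"
    using assms(1) by (meson bounded_pos_less)
  define G where "G = unit_ball_vol (real (DIM('a) - 1)) * (M * R) ^ (DIM('a) - 1)"
  have "hausdorff_premeasure (DIM('a) - 1) \<delta> S \<le> ennreal G" if \<delta>: "\<delta> > 0" for \<delta>
  proof -
    \<comment> \<open>The grid is so fine that every piece has diameter at most
      \<open>\<delta>\<close>; the maximum with 1 secures \<open>N > 0\<close>.\<close>
    obtain N :: nat where N: "N > 0" "M * (2 * R) / \<delta> < real N"
      using reals_Archimedean2[of "max 1 (M * (2 * R) / \<delta>)"]
      by (metis max_less_iff_conj of_nat_0_less_iff zero_less_one order.strict_trans)
    \<comment> \<open>The number of the subinterval containing \<open>y \<bullet> b\<close> when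
      [-R, R] is cut into \<open>N\<close> intervals of length 2R/N.\<close>
    define idx where "idx y b = nat \<lfloor>(y \<bullet> b + R) * N / (2 * R)\<rfloor>" for y b :: 'a
    define I where "I = (B \<rightarrow>\<^sub>E {..<N})"
    define U where "U f = {y \<in> S. \<forall>b\<in>B. idx y b = f b}" for f
    have I: "finite I" "card I = N ^ (DIM('a) - 1)"
      using B by (auto simp: I_def card_PiE finite_PiE)
    have comp: "\<bar>y \<bullet> b\<bar> < R" if "y \<in> S" "b \<in> B" for y b
      using R(2)[OF that(1)] Basis_le_norm[of b y] that(2) by (auto simp: B_def)
    have cover: "S \<subseteq> (\<Union>f\<in>I. U f)"
    proof
      fix y assume y: "y \<in> S"
      have "idx y b < N" if "b \<in> B" for b
      proof -
        have "(y \<bullet> b + R) / (2 * R) < 1" using comp[OF y that] R(1) by (simp add: field_simps)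
        then have "(y \<bullet> b + R) / (2 * R) * real N < 1 * real N"
          using N(1) by (intro mult_strict_right_mono) auto
        then have "\<lfloor>(y \<bullet> b + R) * N / (2 * R)\<rfloor> < int N" by (simp add: floor_less_iff)
        then show ?thesis unfolding idx_def using N(1) by linarith
      qed
      then have "restrict (idx y) B \<in> I" by (auto simp: I_def)
      moreover have "y \<in> U (restrict (idx y) B)" using y by (auto simp: U_def)
      ultimately show "y \<in> (\<Union>f\<in>I. U f)" by blast
    qed
    have diam: "diameter (U f) \<le> M * (2 * R / N)" for f
    proof (rule diameter_le)
      show "U f \<noteq> {} \<or> 0 \<le> M * (2 * R / N)" using M R by simp
      fix y z assume yz: "y \<in> U f" "z \<in> U f"
      have "\<bar>(y - z) \<bullet> b\<bar> \<le> 2 * R / N" if b: "b \<in> B" for b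
      proof -
        let ?p = "\<lambda>y. (y \<bullet> b + R) * N / (2 * R)"
        \<comment> \<open>\<open>nat\<close> collapses negative integers to 0, so equal indices give
          equal floors only for nonnegative arguments.\<close>
        have "0 \<le> ?p y" "0 \<le> ?p z" using comp[OF _ b] yz R(1) by (force simp: U_def)+
        moreover have "idx y b = idx z b" using yz b by (auto simp: U_def)
        ultimately have "\<lfloor>?p y\<rfloor> = \<lfloor>?p z\<rfloor>" by (simp add: idx_def eq_nat_nat_iff)
        then have "\<bar>?p y - ?p z\<bar> \<le> 1" by linarith
        also have "?p y - ?p z = ((y - z) \<bullet> b) * (N / (2 * R))"
          by (simp add: algebra_simps inner_diff_left add_divide_distrib diff_divide_distrib)
        finally show ?thesis using R(1) N(1) by (simp add: abs_mult field_simps)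
      qed
      then show "norm (y - z) \<le> M * (2 * R / N)"
        using dist[of y z "2 * R / N"] yz by (simp add: U_def dist_norm)
    qed
    have U: "bounded (U f) \<and> diameter (U f) \<le> \<delta>" for f
    proof
      show "bounded (U f)" using assms(1) by (rule bounded_subset) (auto simp: U_def)
      have "M * (2 * R / N) \<le> \<delta>" using N \<delta> by (simp add: field_simps)
      then show "diameter (U f) \<le> \<delta>" using diam[of f] by linarith
    qed
    have "hausdorff_premeasure (DIM('a) - 1) \<delta> S \<le> (\<Sum>f\<in>I. hausdorff_gauge (DIM('a) - 1) (U f))"
      using hausdorff_premeasure_le_sum[OF I(1) cover] U \<delta> by simp
    also have "\<dots> \<le> (\<Sum>f\<in>I. ennreal (unit_ball_vol (real (DIM('a) - 1)) * (M * R / N) ^ (DIM('a) - 1)))"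
    proof (rule sum_mono)
      fix f
      have "(diameter (U f) / 2) ^ (DIM('a) - 1) \<le> (M * R / N) ^ (DIM('a) - 1)"
        using diam[of f] U[of f] by (intro power_mono) (auto simp: diameter_ge_0 mult_ac)
      then show "hausdorff_gauge (DIM('a) - 1) (U f)
          \<le> ennreal (unit_ball_vol (real (DIM('a) - 1)) * (M * R / N) ^ (DIM('a) - 1))"
        by (auto simp: hausdorff_gauge_def intro!: ennreal_leI mult_left_mono)
    qed
    also have "\<dots> = of_nat (card I) * ennreal (unit_ball_vol (real (DIM('a) - 1)) * (M * R / N) ^ (DIM('a) - 1))"
      by simp
    also have "\<dots> = ennreal (real (card I) * (unit_ball_vol (real (DIM('a) - 1)) * (M * R / N) ^ (DIM('a) - 1)))"
      by (subst ennreal_mult') (auto simp: ennreal_of_nat_eq_real_of_nat)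
    \<comment> \<open>The N^(d-1) pieces cancel the factor (1/N)^(d-1), which leaves a bound free of
      \<open>\<delta>\<close>.\<close>
    also have "real (card I) * (unit_ball_vol (real (DIM('a) - 1)) * (M * R / N) ^ (DIM('a) - 1)) = G"
      using N(1) by (simp add: I G_def power_divide)
    finally show ?thesis .
  qed
  then have "hausdorff_measure (DIM('a) - 1) S \<le> ennreal G"
    unfolding hausdorff_measure_def by (intro SUP_least) auto
  then show ?thesis by (simp add: order_le_less_trans)
qed

text \<open>Extruding a set of diameter \<open>r \<le> 1\<close> by a unit vector gives a set in a box of volume at most a
  constant times the gauge \<open>r ^ (d - 1)\<close>. This replaces any comparison of Hausdorff with Lebesgue measure on hyperplanes.\<close>

lemma hausdorff_null_cylinder_negligible:
  fixes S :: "'a::euclidean_space set"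
  assumes null: "hausdorff_measure (DIM('a) - 1) S = 0" and e: "e \<in> Basis"
  shows "negligible {s + t *\<^sub>R e | s t. s \<in> S \<and> t \<in> {0..1}}" (is "negligible ?C")
proof -
  define s where "s = DIM('a) - 1"
  \<comment> \<open>For \<open>r \<le> 1\<close> the box below has volume (2r + 1)(2r)^s, at most 3
    (2r)^s = 3 * 4^s (r/2)^s; dividing by the ball volume compares this with the gauge.\<close>
  define k where "k = 3 * 4 ^ s / unit_ball_vol (real s)"
  have k: "k > 0" by (simp add: k_def)
  \<comment> \<open>A box around an arbitrary point of \<open>U\<close>, with half-width
    \<open>diameter U\<close>, lengthened by 1 in direction \<open>e\<close>. It contains the
    extrusion of \<open>U\<close>.\<close>
  define Q :: "'a set \<Rightarrow> 'a set" where
    "Q U = (if U = {} then {} else cbox ((SOME u. u \<in> U) - diameter U *\<^sub>R One)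
        ((SOME u. u \<in> U) + (diameter U *\<^sub>R One + e)))" for U
  have Q_sub: "y + t *\<^sub>R e \<in> Q U" if "y \<in> U" "bounded U" "t \<in> {0..1}" for y t U
  proof -
    define u where "u = (SOME u. u \<in> U)"
    have u: "u \<in> U" using that(1) unfolding u_def by (metis someI)
    have *: "\<bar>(y - u) \<bullet> b\<bar> \<le> diameter U" if "b \<in> Basis" for b
      using diameter_bounded_bound[OF \<open>bounded U\<close> \<open>y \<in> U\<close> u] Basis_le_norm[OF that, of "y - u"]
      by (simp add: dist_norm)
    have "u \<bullet> b - diameter U \<le> (y + t *\<^sub>R e) \<bullet> b \<and>
        (y + t *\<^sub>R e) \<bullet> b \<le> u \<bullet> b + (diameter U + e \<bullet> b)" if "b \<in> Basis" for b
      using *[OF that] e that \<open>t \<in> {0..1}\<close> by (auto simp: inner_left_distrib inner_diff_left inner_Basis)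
    then show ?thesis using that(1)
      by (auto simp: Q_def u_def[symmetric] mem_box inner_left_distrib inner_diff_left)
  qed
  have Q_vol: "emeasure lborel (Q U) \<le> ennreal k * hausdorff_gauge s U"
    if "bounded U" "diameter U \<le> 1" for U
  proof (cases "U = {}")
    case False
    define r where "r = diameter U"
    have r: "0 \<le> r" "r \<le> 1" using that by (auto simp: r_def diameter_ge_0)
    have "emeasure lborel (Q U) = ennreal (\<Prod>b\<in>Basis. 2 * r + e \<bullet> b)"
      using False r e unfolding Q_def r_def[symmetric]
      by (subst if_not_P, simp, subst emeasure_lborel_cbox)
        (auto simp: inner_left_distrib inner_diff_left inner_Basis algebra_simps intro!: prod.cong arg_cong[where f=ennreal])
    also have "(\<Prod>b\<in>Basis. 2 * r + e \<bullet> b) = (2 * r + 1) * (\<Prod>b\<in>Basis - {e}. 2 * r + e \<bullet> b)"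
      using e by (subst prod.remove[OF _ e]) auto
    also have "(\<Prod>b\<in>Basis - {e}. 2 * r + e \<bullet> b) = (\<Prod>b\<in>Basis - {e}. 2 * r)"
      using e by (intro prod.cong) (auto simp: inner_Basis)
    also have "\<dots> = (2 * r) ^ s" using e by (simp add: s_def)
    also have "(2 * r + 1) * (2 * r) ^ s \<le> 3 * (2 * r) ^ s"
      using r by (intro mult_right_mono) auto
    also have "3 * (2 * r) ^ s = k * (unit_ball_vol (real s) * (r / 2) ^ s)"
    proof -
      have "(2 * r) ^ s = 4 ^ s * (r / 2) ^ s" unfolding power_mult_distrib[symmetric] by simp
      moreover have "unit_ball_vol (real s) \<noteq> 0" using unit_ball_vol_pos[of "real s"] by linarith
      ultimately show ?thesis by (simp add: k_def)
    qed
    also have "ennreal \<dots> = ennreal k * hausdorff_gauge s U"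
      using False k by (subst ennreal_mult') (auto simp: hausdorff_gauge_def r_def)
    finally show ?thesis by (simp add: ennreal_leI)
  qed (simp add: Q_def)
  \<comment> \<open>Scale 1 suffices: it lies below the supremum and provides the bound on the
    diameters that \<open>Q_vol\<close> requires.\<close>
  have "hausdorff_premeasure s 1 S = 0"
  proof -
    have "hausdorff_premeasure s 1 S \<le> hausdorff_measure s S"
      unfolding hausdorff_measure_def by (intro SUP_upper) auto
    then show ?thesis using null by (simp add: s_def)
  qed
  show ?thesis
    unfolding negligible_outer_le
  proof (intro allI impI)
    fix \<epsilon> :: real assume \<epsilon>: "\<epsilon> > 0"
    have "hausdorff_premeasure s 1 S < ennreal (\<epsilon> / k)"
      using \<open>hausdorff_premeasure s 1 S = 0\<close> \<epsilon> k by simp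
    then obtain U where U: "S \<subseteq> (\<Union>i. U i)" "\<And>i::nat. bounded (U i) \<and> diameter (U i) \<le> 1"
      "(\<Sum>i. hausdorff_gauge s (U i)) < ennreal (\<epsilon> / k)"
      unfolding hausdorff_premeasure_def Inf_less_iff by blast
    let ?N = "\<Union>i. Q (U i)"
    have meas: "Q V \<in> sets lborel" for V by (simp add: Q_def)
    have "emeasure lborel ?N \<le> (\<Sum>i. emeasure lborel (Q (U i)))"
      using meas by (intro emeasure_subadditive_countably) auto
    also have "\<dots> \<le> (\<Sum>i. ennreal k * hausdorff_gauge s (U i))"
      using Q_vol U(2) by (intro suminf_le) auto
    also have "\<dots> = ennreal k * (\<Sum>i. hausdorff_gauge s (U i))" by simp
    also have "\<dots> \<le> ennreal k * ennreal (\<epsilon> / k)" using U(3) by (intro mult_left_mono) auto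
    also have "\<dots> = ennreal \<epsilon>" using k \<epsilon> by (simp flip: ennreal_mult')
    finally have N: "emeasure lborel ?N \<le> ennreal \<epsilon>" .
    have Nm: "?N \<in> sets lborel" using meas by (intro sets.countable_UN) auto
    then have NL: "emeasure lebesgue ?N \<le> ennreal \<epsilon>" using N by simp
    have "?N \<in> lmeasurable"
      using Nm NL by (intro fmeasurableI) (auto simp: order_le_less_trans)
    moreover have "measure lebesgue ?N \<le> \<epsilon>"
      using NL \<epsilon> by (simp add: measure_def enn2real_leI)
    moreover have "?C \<subseteq> ?N"
    proof
      fix z assume "z \<in> ?C"
      then obtain y t where z: "z = y + t *\<^sub>R e" "y \<in> S" "t \<in> {0..1}" by blast
      then obtain i where "y \<in> U i" using U(1) by blast
      then show "z \<in> ?N" using Q_sub U(2) z by blast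
    qed
    ultimately show "\<exists>T. ?C \<subseteq> T \<and> T \<in> lmeasurable \<and> measure lebesgue T \<le> \<epsilon>" by blast
  qed
qed

text \<open>Otherwise extruding \<open>S\<close> along a suitable basis vector yields a convex set
  of full affine dimension. Such a set has nonempty interior, yet the extrusion is
  negligible.\<close>

lemma convex_hausdorff_null_aff_dim:
  fixes S :: "'a::euclidean_space set"
  assumes "convex S" "hausdorff_measure (DIM('a) - 1) S = 0"
  shows "aff_dim S < int DIM('a) - 1"
proof (cases "S = {}")
  case False
  then obtain s where s: "s \<in> S" by blast
  show ?thesis
  proof (rule ccontr)
    assume big: "\<not> aff_dim S < int DIM('a) - 1"
    \<comment> \<open>Either some basis vector leaves the affine hull and raises the dimension to
      the full one, or the directions of the affine hull contain \<open>Basis\<close>, so the hull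
      is the whole space and any \<open>e\<close> serves.\<close>
    obtain e where e: "e \<in> Basis" "aff_dim (insert (s + e) S) = int DIM('a)"
    proof (cases "\<exists>e\<in>Basis. s + e \<notin> affine hull S")
      case True
      then obtain e where "e \<in> Basis" "s + e \<notin> affine hull S" by blast
      then have "aff_dim (insert (s + e) S) = aff_dim S + 1" by (simp add: aff_dim_insert)
      then have "aff_dim (insert (s + e) S) = int DIM('a)"
        using big aff_dim_le_DIM[of "insert (s + e) S"] by linarith
      then show ?thesis using that \<open>e \<in> Basis\<close> by blast
    next
      case False
      let ?V = "(\<lambda>y. - s + y) ` (affine hull S)"
      have "s \<in> affine hull S" using s by (rule hull_inc)
      then have "subspace ?V" by (intro affine_diffs_subspace) (auto simp: affine_affine_hull)
      moreover have "Basis \<subseteq> ?V" using False by (force simp: image_iff)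
      ultimately have "?V = UNIV" by (metis span_Basis span_minimal UNIV_I subsetI subset_antisym)
      then have "affine hull S = UNIV"
        by (metis (no_types, lifting) UNIV_eq_I UNIV_I image_iff add_left_cancel)
      then have "aff_dim S = int DIM('a)" using aff_dim_affine_hull[of S] by simp
      moreover obtain e :: 'a where "e \<in> Basis" using nonempty_Basis by blast
      ultimately show ?thesis
        using that aff_dim_subset[of S "insert (s + e) S"] aff_dim_le_DIM[of "insert (s + e) S"]
        by (metis order_antisym subset_insertI)
    qed
    let ?C = "{s + t *\<^sub>R e | s t. s \<in> S \<and> t \<in> {0..1}}"
    \<comment> \<open>The extrusion is the Minkowski sum of \<open>S\<close> and the segment from 0
      to \<open>e\<close>, hence convex.\<close>
    have C: "?C = (\<Union>s\<in>S. \<Union>y\<in>closed_segment 0 e. {s + y})"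
    proof (intro equalityI subsetI)
      fix z assume "z \<in> ?C"
      then obtain y t where "z = y + t *\<^sub>R e" "y \<in> S" "0 \<le> t" "t \<le> 1" by auto
      moreover from this have "t *\<^sub>R e \<in> closed_segment 0 e" by (auto simp: in_segment)
      ultimately show "z \<in> (\<Union>s\<in>S. \<Union>y\<in>closed_segment 0 e. {s + y})" by blast
    qed (auto simp: in_segment; blast)
    have "convex ?C" unfolding C using assms(1) by (intro convex_sums) auto
    moreover have "negligible ?C"
      using hausdorff_null_cylinder_negligible[OF assms(2) e(1)] .
    ultimately have "interior ?C = {}" by (simp add: negligible_convex_interior)
    have "insert (s + e) S \<subseteq> ?C"
    proof -
      have "s + 1 *\<^sub>R e \<in> ?C" using s by (intro CollectI exI conjI) (rule refl, auto)
      moreover have "y + 0 *\<^sub>R e \<in> ?C" if "y \<in> S" for y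
        using that by (intro CollectI exI conjI) (rule refl, auto)
      ultimately show ?thesis by auto
    qed
    then have C_sub: "aff_dim (insert (s + e) S) \<le> aff_dim ?C" "?C \<noteq> {}"
      by (rule aff_dim_subset, blast)
    then have "aff_dim ?C = int DIM('a)"
      using e(2) aff_dim_le_DIM[of ?C] by linarith
    then have "interior ?C = rel_interior ?C" by (simp add: interior_rel_interior_gen)
    then show False
      using \<open>convex ?C\<close> \<open>interior ?C = {}\<close> C_sub(2) by (simp add: rel_interior_eq_empty)
  qed
qed (use DIM_positive[where 'a='a] in simp)

section \<open>Geometry of Voronoi meshes\<close>

text \<open>After squaring, \<open>y \<bullet> y\<close> cancels, so each comparison of distances is
  affine in \<open>y\<close>. Convexity of the cells follows from this form.\<close>

lemma voronoi_cell_halfspaces: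
  "voronoi_cell X p = (\<Inter>q\<in>X. {y. (2 *\<^sub>R (q - p)) \<bullet> y \<le> q \<bullet> q - p \<bullet> p})"
proof -
  have "dist y p \<le> dist y q \<longleftrightarrow> (2 *\<^sub>R (q - p)) \<bullet> y \<le> q \<bullet> q - p \<bullet> p" for y q
    unfolding dist_norm norm_le by (simp add: algebra_simps inner_commute)
  then show ?thesis by (auto simp: voronoi_cell_def)
qed

lemma convex_voronoi_cell: "convex (voronoi_cell X p)"
  unfolding voronoi_cell_halfspaces by (intro convex_INT convex_halfspace_le)

lemma voronoi_cell_Int_subset_bisector:
  assumes "p \<in> X" "q \<in> X"
  shows "voronoi_cell X p \<inter> voronoi_cell X q \<subseteq> {y. (2 *\<^sub>R (q - p)) \<bullet> y = q \<bullet> q - p \<bullet> p}"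
proof
  fix y assume "y \<in> voronoi_cell X p \<inter> voronoi_cell X q"
  then have "dist y p = dist y q" using assms by (auto simp: voronoi_cell_def intro: antisym)
  then show "y \<in> {y. (2 *\<^sub>R (q - p)) \<bullet> y = q \<bullet> q - p \<bullet> p}"
    unfolding dist_norm norm_eq by (simp add: algebra_simps inner_commute)
qed

lemma interior_voronoi_cell_nonempty:
  assumes "locally_finite_points X"
  shows "interior (voronoi_cell X p) \<noteq> {}"
proof -
  have "finite (X \<inter> cball p 1)" using assms by (simp add: locally_finite_points_def)
  from finite_set_avoid[OF this, of p] obtain \<delta> where
    \<delta>: "\<delta> > 0" "\<And>q. q \<in> X \<Longrightarrow> dist p q \<le> 1 \<Longrightarrow> q \<noteq> p \<Longrightarrow> \<delta> \<le> dist p q"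
    by auto
  \<comment> \<open>\<open>\<delta>\<close> controls only the generators within distance 1 of
    \<open>p\<close>; the minimum with 1 handles the farther ones. Half of it suffices by the
    triangle inequality.\<close>
  have "ball p (min \<delta> 1 / 2) \<subseteq> voronoi_cell X p"
  proof
    fix y assume y: "y \<in> ball p (min \<delta> 1 / 2)"
    have "dist y p \<le> dist y q" if "q \<in> X" for q
    proof (cases "q = p")
      case False
      then have "min \<delta> 1 \<le> dist p q" using \<delta>(2)[OF that] by linarith
      moreover have "2 * dist p y < min \<delta> 1" using y by simp
      ultimately show ?thesis 
        using dist_triangle[of p q y] dist_commute[of p y] dist_commute[of q y] by linarith
    qed simp
    then show "y \<in> voronoi_cell X p" by (simp add: voronoi_cell_def)
  qed
  then have "ball p (min \<delta> 1 / 2) \<subseteq> interior (voronoi_cell X p)"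
    by (simp add: interior_maximal)
  moreover have "p \<in> ball p (min \<delta> 1 / 2)" using \<delta>(1) by simp
  ultimately show ?thesis by blast
qed

section \<open>Cells, faces and the neighbour graph of a fixed mesh\<close>

context
  fixes \<Omega> :: "'a::euclidean_space set" and h :: real and T :: "'a set set" and x :: "'a set \<Rightarrow> 'a"
  assumes mesh: "voronoi_mesh \<Omega> h T x"
begin

lemma mesh_finite: "finite T" and mesh_cover: "\<Omega> \<subseteq> \<Union>T"
  using mesh by (auto simp: voronoi_mesh_def)

lemma mesh_cell_compact: "K \<in> T \<Longrightarrow> compact K" and mesh_cell_meets: "K \<in> T \<Longrightarrow> K \<inter> \<Omega> \<noteq> {}"
  using mesh by (auto simp: voronoi_mesh_def)

lemma mesh_cell_convex: "K \<in> T \<Longrightarrow> convex K"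
  using mesh convex_voronoi_cell by (metis voronoi_mesh_def)

lemma mesh_cell_interior: "K \<in> T \<Longrightarrow> interior K \<noteq> {}"
  using mesh interior_voronoi_cell_nonempty by (metis voronoi_mesh_def)

lemma mesh_generator_inj: "K \<in> T \<Longrightarrow> L \<in> T \<Longrightarrow> x K = x L \<Longrightarrow> K = L"
  using mesh by (metis voronoi_mesh_def)

lemma mesh_cell_vol_pos:
  assumes "K \<in> T"
  shows "vol K > 0"
proof -
  have "\<not> negligible K"
    using mesh_cell_convex[OF assms] mesh_cell_interior[OF assms] by (simp add: negligible_convex_interior)
  moreover have "K \<in> lmeasurable" using mesh_cell_compact[OF assms] by (rule lmeasurable_compact)
  ultimately show ?thesis
    by (metis negligible_iff_measure measure_nonneg order_le_less)
qed

lemma mesh_face_finite: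
  assumes "K \<in> T" "L \<in> T" "K \<noteq> L"
  shows "face_measure K L < \<infinity>"
proof -
  obtain X where X: "\<forall>K\<in>T. x K \<in> X \<and> K = voronoi_cell X (x K)"
    using mesh by (auto simp: voronoi_mesh_def)
  have "bounded (K \<inter> L)" using mesh_cell_compact[OF assms(1)] by (auto intro: compact_imp_bounded bounded_subset)
  moreover have "2 *\<^sub>R (x L - x K) \<noteq> 0" using mesh_generator_inj assms by auto
  moreover have "K \<inter> L \<subseteq> {y. (2 *\<^sub>R (x L - x K)) \<bullet> y = x L \<bullet> x L - x K \<bullet> x K}"
    using voronoi_cell_Int_subset_bisector[of "x K" X "x L"] X assms by metis
  ultimately show ?thesis by (rule hausdorff_measure_hyperplane_finite)
qed

text \<open>Finiteness of the face measure matters because \<open>enn2real\<close> maps infinity to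
  0, and distinct generators keep the denominator nonzero.\<close>

lemma transmission_pos:
  assumes "K \<in> T" "L \<in> neighbors T K"
  shows "transmission x K L > 0"
proof -
  have L: "L \<in> T" "L \<noteq> K" "face_measure K L > 0" using assms(2) by (auto simp: neighbors_def)
  then have "enn2real (face_measure K L) > 0"
    using mesh_face_finite[OF assms(1) L(1)] by (auto simp: enn2real_positive_iff top.not_eq_extremum)
  moreover have "x K \<noteq> x L" using mesh_generator_inj L assms(1) by metis
  ultimately show ?thesis by (simp add: transmission_def)
qed

text \<open>A segment between generic points of two cells misses all faces of codimension at least two,
  since these span, together with the first point, only a null set.\<close>

lemma mesh_graph_connected:
  assumes \<Omega>: "open \<Omega>" "connected \<Omega>" and A: "A \<subseteq> T" "A \<noteq> {}" "A \<noteq> T"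
  shows "\<exists>K\<in>A. \<exists>L\<in>T - A. L \<in> neighbors T K"
proof (rule ccontr)
  assume not_adj: "\<not> ?thesis"
  have fin: "finite A" "finite (T - A)" using mesh_finite A(1) by (auto intro: finite_subset)
  \<comment> \<open>With no edge leaving \<open>A\<close>, every contact between \<open>A\<close>
    and its complement has measure zero and therefore codimension at least two.\<close>
  have low: "aff_dim (K \<inter> L) < int DIM('a) - 1" if KL: "K \<in> A" "L \<in> T - A" for K L
  proof (rule convex_hausdorff_null_aff_dim)
    show "convex (K \<inter> L)" using KL A(1) mesh_cell_convex by (intro convex_Int) auto
    show "hausdorff_measure (DIM('a) - 1) (K \<inter> L) = 0"
      using not_adj KL A(1) by (force simp: neighbors_def)
  qed
  have null: "negligible S" if "aff_dim S < int DIM('a)" for S :: "'a set"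
  proof -
    have "interior (affine hull S) = {}"
      using that by (simp add: low_dim_interior)
    then have "negligible (affine hull S)"
      by (simp add: negligible_convex_interior convex_affine_hull affine_imp_convex)
    then show ?thesis by (rule negligible_subset) (rule hull_subset)
  qed
  have cl: "closed (\<Union>A)" "closed (\<Union>(T - A))"
    using fin A(1) mesh_cell_compact by (auto intro!: closed_Union compact_imp_closed)
  \<comment> \<open>The unions of the two families do not meet inside \<open>\<Omega>\<close>. Near
    a common point, a generic segment would otherwise be split into two disjoint closed
    pieces.\<close>
  have "p \<notin> \<Union>(T - A)" if p: "p \<in> \<Omega>" "p \<in> \<Union>A" for p
  proof
    assume "p \<in> \<Union>(T - A)"
    then obtain K L where K: "K \<in> A" "p \<in> K" and L: "L \<in> T - A" "p \<in> L" using p(2) by blast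
    obtain r where r: "r > 0" "ball p r \<subseteq> \<Omega>" using \<Omega>(1) p(1) openE by blast
    \<comment> \<open>\<open>p\<close> may be a boundary point of the cell, but a convex set with
      nonempty interior lies in the closure of that interior.\<close>
    have fat: "open (interior M \<inter> ball p r) \<and> interior M \<inter> ball p r \<noteq> {}" if M: "M \<in> T" "p \<in> M" for M
    proof -
      have "closure (interior M) = closure M"
        using M mesh_cell_convex mesh_cell_interior by (simp add: convex_closure_interior)
      then have "p \<in> closure (interior M)" using M closure_subset by blast
      then have "interior M \<inter> ball p r \<noteq> {}"
        using r(1) by (metis open_Int_closure_eq_empty centre_in_ball disjoint_iff inf_commute open_ball)
      then show ?thesis by auto
    qed
    have UN: "negligible (\<Union>K\<in>A. \<Union>L\<in>T - A. f K L)"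
      if "\<And>K L. K \<in> A \<Longrightarrow> L \<in> T - A \<Longrightarrow> negligible (f K L)" for f
      using fin that by (intro negligible_Union) auto
    define F where "F = (\<Union>K\<in>A. \<Union>L\<in>T - A. K \<inter> L)"
    have "negligible F"
      unfolding F_def using low null by (intro UN) force
    then have "\<not> interior K \<inter> ball p r \<subseteq> F"
      using fat[of K] K A(1) open_not_negligible negligible_subset by blast
    then obtain a where a: "a \<in> K" "a \<in> ball p r" "a \<notin> F" using interior_subset by blast
    \<comment> \<open>The cones over the contacts as seen from \<open>a\<close>, enlarged to affine
      hulls. Adding \<open>a\<close> raises the dimension by at most one, so each stays below the
      full dimension.\<close>
    define H where "H = (\<Union>K\<in>A. \<Union>L\<in>T - A. affine hull insert a (K \<inter> L))"
    have "negligible (affine hull insert a (K \<inter> L))" if "K \<in> A" "L \<in> T - A" for K L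
      using low[OF that] by (intro null) (simp add: aff_dim_affine_hull aff_dim_insert)
    then have "negligible H"
      unfolding H_def by (intro UN)
    then have "\<not> interior L \<inter> ball p r \<subseteq> H"
      using fat[of L] L A(1) open_not_negligible negligible_subset by blast
    then obtain b where b: "b \<in> L" "b \<in> ball p r" "b \<notin> H" using interior_subset by blast
    have seg: "closed_segment a b \<subseteq> \<Omega>"
      using r(2) a(2) b(2) by (meson closed_segment_subset convex_ball subset_trans)
    have "z \<notin> F" if z: "z \<in> closed_segment a b" for z
    proof
      assume "z \<in> F"
      then obtain K' L' where KL: "K' \<in> A" "L' \<in> T - A" "z \<in> K' \<inter> L'" by (auto simp: F_def)
      obtain t where t: "z = (1 - t) *\<^sub>R a + t *\<^sub>R b" using z by (auto simp: in_segment)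
      have "t \<noteq> 0" using t \<open>z \<in> F\<close> a(3) by auto
      \<comment> \<open>A contact point on the segment would put \<open>b\<close> on the line
        through \<open>a\<close> and that point, hence in \<open>H\<close>.\<close>
      have "b = (1 - 1 / t) *\<^sub>R a + (1 / t) *\<^sub>R z"
        using \<open>t \<noteq> 0\<close> unfolding t by (simp add: algebra_simps)
      moreover have "a \<in> affine hull insert a (K' \<inter> L')" "z \<in> affine hull insert a (K' \<inter> L')"
        using KL(3) by (auto intro: hull_inc)
      ultimately have "b \<in> affine hull insert a (K' \<inter> L')"
        using affine_affine_hull[of "insert a (K' \<inter> L')"] by (simp add: affine_alt)
      then show False using b(3) KL by (auto simp: H_def)
    qed
    then have "\<Union>A \<inter> \<Union>(T - A) \<inter> closed_segment a b = {}" by (auto simp: F_def)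
    moreover have "closed_segment a b \<subseteq> \<Union>A \<union> \<Union>(T - A)" using seg mesh_cover A(1) by blast
    moreover have "a \<in> \<Union>A \<inter> closed_segment a b" "b \<in> \<Union>(T - A) \<inter> closed_segment a b"
      using a(1) b(1) K L by auto
    ultimately show False
      using connected_segment(1)[of a b] cl unfolding connected_closed by blast
  qed
  \<comment> \<open>Two disjoint relatively closed parts, both nonempty, now cover
    \<open>\<Omega>\<close>, against its connectedness.\<close>
  then have "\<Union>A \<inter> \<Union>(T - A) \<inter> \<Omega> = {}" by blast
  moreover have "\<Omega> \<subseteq> \<Union>A \<union> \<Union>(T - A)" using mesh_cover A(1) by blast
  moreover have "\<Union>A \<inter> \<Omega> \<noteq> {}" "\<Union>(T - A) \<inter> \<Omega> \<noteq> {}" using A mesh_cell_meets by blast+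
  ultimately show False using \<Omega>(2) cl unfolding connected_closed by blast
qed

end

section \<open>Flux, free energy and dissipation\<close>

text \<open>Pulling out the exponential of the mean potential turns the half exponents of
  \<open>p - q\<close> into \<open>p / \<kappa>\<close> and \<open>q / \<kappa>\<close>. The
  remaining factor \<open>v / S\<close> is positive since \<open>S\<close> has the sign of
  \<open>v\<close>; \<open>p = q\<close> is the separate branch of \<open>theta\<close>.\<close>

lemma theta_factor:
  assumes "\<kappa> > 0"
  obtains g where "g > 0" "theta \<kappa> a b (p - q) = g * (a * exp (p / \<kappa>) - b * exp (q / \<kappa>))"
proof (cases "p = q")
  case True
  show ?thesis
  proof
    show "\<kappa> * exp (- p / \<kappa>) > 0" using assms by simp
    show "theta \<kappa> a b (p - q) = \<kappa> * exp (- p / \<kappa>) * (a * exp (p / \<kappa>) - b * exp (q / \<kappa>))"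
      using True by (simp add: theta_def algebra_simps exp_minus)
  qed
next
  case False
  define v where "v = p - q"
  define m where "m = (p + q) / (2 * \<kappa>)"
  define S where "S = exp (v / (2 * \<kappa>)) - exp (- v / (2 * \<kappa>))"
  have v: "v \<noteq> 0" using False by (simp add: v_def)
  have e: "exp (v / (2 * \<kappa>)) = exp (- m) * exp (p / \<kappa>)" "exp (- v / (2 * \<kappa>)) = exp (- m) * exp (q / \<kappa>)"
    unfolding exp_add[symmetric] using assms by (simp_all add: v_def m_def field_simps)
  have "v / S > 0"
  proof (cases "v > 0")
    case True
    then have "S > 0" using assms unfolding S_def by (simp add: divide_strict_right_mono)
    then show ?thesis using True by simp
  next
    case False
    then have "v < 0" using v by simp
    moreover from this have "v / (2 * \<kappa>) < 0" using assms by (intro divide_neg_pos) auto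
    then have "S < 0" unfolding S_def by simp
    ultimately show ?thesis by (rule divide_neg_neg)
  qed
  show ?thesis
  proof
    show "v / S * exp (- m) > 0" using \<open>v / S > 0\<close> by (intro mult_pos_pos) auto
    have "theta \<kappa> a b v = v / S * (a * exp (v / (2 * \<kappa>)) - b * exp (- v / (2 * \<kappa>)))"
      using v by (simp add: theta_def S_def)
    also have "\<dots> = v / S * exp (- m) * (a * exp (p / \<kappa>) - b * exp (q / \<kappa>))"
      unfolding e by (simp add: algebra_simps)
    finally show "theta \<kappa> a b (p - q) = v / S * exp (- m) * (a * exp (p / \<kappa>) - b * exp (q / \<kappa>))"
      by (simp add: v_def)
  qed
qed

text \<open>For positive densities \<open>alpha\<close> is a positive multiple of (ln u - ln w)(u -
  w), and \<open>ln\<close> is strictly increasing. If exactly one density vanishes,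
  \<open>alpha\<close> is infinite and the weighted values differ; if both vanish, both sides are
  zero.\<close>

lemma alpha_nonneg_zero_iff:
  assumes "\<kappa> > 0" "a \<ge> 0" "b \<ge> 0"
  shows "alpha \<kappa> a b (p - q) \<ge> 0 \<and>
    (alpha \<kappa> a b (p - q) = 0 \<longleftrightarrow> a * exp (p / \<kappa>) = b * exp (q / \<kappa>))"
proof (cases "a > 0 \<and> b > 0")
  case True
  define u w where "u = a * exp (p / \<kappa>)" and "w = b * exp (q / \<kappa>)"
  have uw: "u > 0" "w > 0" using True by (auto simp: u_def w_def)
  obtain g where g: "g > 0" "theta \<kappa> a b (p - q) = g * (u - w)"
    using theta_factor[OF assms(1)] unfolding u_def w_def by metis
  have "ln (a * exp ((p - q) / (2 * \<kappa>))) - ln (b * exp (- (p - q) / (2 * \<kappa>))) = ln u - ln w"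
    using True assms(1) by (simp add: u_def w_def ln_mult field_simps)
  then have alpha: "alpha \<kappa> a b (p - q) = ereal (g * ((ln u - ln w) * (u - w)))"
    using True g(2) by (simp add: alpha_def mult_ac)
  have "(ln u - ln w) * (u - w) \<ge> 0"
    using uw by (cases "u \<le> w") (auto intro: mult_nonpos_nonpos)
  then show ?thesis
    using g(1) uw unfolding alpha u_def[symmetric] w_def[symmetric] by simp
qed (use assms in \<open>auto simp: alpha_def\<close>)

section \<open>Potential, first variation of the free energy and Gibbs states\<close>

definition mesh_potential ::
  "('a::euclidean_space \<Rightarrow> real) \<Rightarrow> 'a set set \<Rightarrow> ('a set \<Rightarrow> 'a) \<Rightarrow> ('a set \<Rightarrow> real) \<Rightarrow> 'a set \<Rightarrow> real"
  where "mesh_potential W T x \<rho> K = (\<Sum>J\<in>T. vol J * \<rho> J * W (x K - x J))"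

text \<open>Brings the velocity into the form \<open>p - q\<close> required by
  \<open>theta_factor\<close> and \<open>alpha_nonneg_zero_iff\<close>.\<close>

lemma dist_times_drift:
  assumes "x K \<noteq> x L"
  shows "dist (x K) (x L) * drift W T x \<rho> K L = mesh_potential W T x \<rho> K - mesh_potential W T x \<rho> L"
proof -
  have "dist (x K) (x L) * drift W T x \<rho> K L
      = (\<Sum>J\<in>T. vol J * \<rho> J * (W (x K - x J) - W (x L - x J)))"
    unfolding drift_def sum_distrib_left using assms by (intro sum.cong) auto
  then show ?thesis
    by (simp add: mesh_potential_def right_diff_distrib sum_subtractf)
qed

text \<open>The extra term of the entropy derivative is the total mass of the perturbation, which is
  zero. Symmetry of \<open>W\<close> makes the two halves of the interaction derivative equal and so
  absorbs the factor 1/2.\<close>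

lemma free_energy_derivative:
  assumes pos: "\<And>K. K \<in> T \<Longrightarrow> \<rho> K > 0" and W: "\<And>z. W z = W (- z)"
    and s: "(\<Sum>K\<in>T. vol K * s K) = 0" and \<kappa>: "\<kappa> > 0"
  shows "((\<lambda>\<epsilon>. free_energy \<kappa> W T x (\<lambda>K. \<rho> K + \<epsilon> * s K)) has_real_derivative
    \<kappa> * (\<Sum>K\<in>T. vol K * s K * ln (\<rho> K * exp (mesh_potential W T x \<rho> K / \<kappa>)))) (at 0)"
proof -
  have "((\<lambda>\<epsilon>. vol K * ((\<rho> K + \<epsilon> * s K) * ln (\<rho> K + \<epsilon> * s K))) has_real_derivative
      vol K * (s K * ln (\<rho> K) + s K)) (at 0)" if "K \<in> T" for K
    using pos[OF that] by (auto intro!: derivative_eq_intros simp: field_simps)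
  then have entropy: "((\<lambda>\<epsilon>. \<Sum>K\<in>T. vol K * ((\<rho> K + \<epsilon> * s K) * ln (\<rho> K + \<epsilon> * s K))) has_real_derivative
      (\<Sum>K\<in>T. vol K * (s K * ln (\<rho> K) + s K))) (at 0)"
    by (intro DERIV_sum) auto
  let ?c = "\<lambda>K L. vol K * vol L * W (x K - x L)"
  have interaction: "((\<lambda>\<epsilon>. \<Sum>K\<in>T. \<Sum>L\<in>T. ?c K L * (\<rho> K + \<epsilon> * s K) * (\<rho> L + \<epsilon> * s L)) has_real_derivative
      (\<Sum>K\<in>T. \<Sum>L\<in>T. ?c K L * (s K * \<rho> L + \<rho> K * s L))) (at 0)"
    by (intro DERIV_sum) (auto intro!: derivative_eq_intros simp: algebra_simps)
  have swap: "(\<Sum>K\<in>T. \<Sum>L\<in>T. ?c K L * (\<rho> K * s L)) = (\<Sum>K\<in>T. \<Sum>L\<in>T. ?c K L * (s K * \<rho> L))"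
    by (subst sum.swap) (intro sum.cong refl, subst W, simp)
  have potential: "(\<Sum>K\<in>T. \<Sum>L\<in>T. ?c K L * (s K * \<rho> L)) = (\<Sum>K\<in>T. vol K * s K * mesh_potential W T x \<rho> K)"
    by (simp add: mesh_potential_def sum_distrib_left mult_ac)
  have "(\<Sum>K\<in>T. vol K * s K * ln (\<rho> K * exp (mesh_potential W T x \<rho> K / \<kappa>)))
      = (\<Sum>K\<in>T. vol K * (s K * ln (\<rho> K)) + (vol K * s K * mesh_potential W T x \<rho> K) / \<kappa>)"
    using pos by (intro sum.cong) (auto simp: ln_mult_pos distrib_left)
  also have "\<dots> = (\<Sum>K\<in>T. vol K * (s K * ln (\<rho> K))) + (\<Sum>K\<in>T. vol K * s K * mesh_potential W T x \<rho> K) / \<kappa>"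
    by (simp add: sum.distrib sum_divide_distrib)
  finally have "\<kappa> * (\<Sum>K\<in>T. vol K * s K * ln (\<rho> K * exp (mesh_potential W T x \<rho> K / \<kappa>)))
      = \<kappa> * (\<Sum>K\<in>T. vol K * (s K * ln (\<rho> K) + s K))
        + 1 / 2 * (\<Sum>K\<in>T. \<Sum>L\<in>T. ?c K L * (s K * \<rho> L + \<rho> K * s L))"
    using \<kappa> s by (simp add: distrib_left sum.distrib swap potential)
  then show ?thesis
    unfolding free_energy_def
    using DERIV_add[OF DERIV_cmult[OF entropy, of \<kappa>] DERIV_cmult[OF interaction, of "1 / 2"]]
    by simp
qed

text \<open>A linear functional that vanishes on all perturbations of zero mass has constant
  density; here that density is \<open>ln u\<close>.\<close>

lemma critical_point_iff:
  assumes fin: "finite T" and vol: "\<And>K. K \<in> T \<Longrightarrow> vol K > 0"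
    and W: "\<And>z. W z = W (- z)" and \<kappa>: "\<kappa> > 0"
  shows "critical_point \<kappa> W T x \<rho> \<longleftrightarrow> (\<forall>K\<in>T. \<rho> K > 0) \<and>
    (\<exists>c. \<forall>K\<in>T. \<rho> K * exp (mesh_potential W T x \<rho> K / \<kappa>) = c)"
proof (cases "\<forall>K\<in>T. \<rho> K > 0")
  case pos: True
  define u where "u K = \<rho> K * exp (mesh_potential W T x \<rho> K / \<kappa>)" for K
  have u: "u K > 0" if "K \<in> T" for K using pos that by (simp add: u_def)
  have "((\<lambda>\<epsilon>. (free_energy \<kappa> W T x (\<lambda>K. \<rho> K + \<epsilon> * s K) - free_energy \<kappa> W T x \<rho>) / \<epsilon>) \<longlongrightarrow> 0) (at 0)
      \<longleftrightarrow> (\<Sum>K\<in>T. vol K * s K * ln (u K)) = 0"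
    if s: "(\<Sum>K\<in>T. vol K * s K) = 0" for s
  proof -
    have "((\<lambda>\<epsilon>. (free_energy \<kappa> W T x (\<lambda>K. \<rho> K + \<epsilon> * s K) - free_energy \<kappa> W T x \<rho>) / \<epsilon>) \<longlongrightarrow>
        \<kappa> * (\<Sum>K\<in>T. vol K * s K * ln (u K))) (at 0)"
      using free_energy_derivative[of T \<rho> W s \<kappa> x] pos W s \<kappa>
      by (simp add: u_def DERIV_def)
    then show ?thesis
      using \<kappa> LIM_unique[of _ 0 0] by fastforce
  qed
  then have crit: "critical_point \<kappa> W T x \<rho> \<longleftrightarrow>
      (\<forall>s. (\<Sum>K\<in>T. vol K * s K) = 0 \<longrightarrow> (\<Sum>K\<in>T. vol K * s K * ln (u K)) = 0)"
    using pos by (simp add: critical_point_def)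
  have "(\<exists>c. \<forall>K\<in>T. u K = c)"
    if stat: "\<forall>s. (\<Sum>K\<in>T. vol K * s K) = 0 \<longrightarrow> (\<Sum>K\<in>T. vol K * s K * ln (u K)) = 0"
  proof -
    have "u K = u L" if KL: "K \<in> T" "L \<in> T" for K L
    proof (cases "K = L")
      case False
      \<comment> \<open>Transfers the mass \<open>vol K * vol L\<close> from \<open>L\<close> to
        \<open>K\<close>, so the total mass is unchanged and only two values of \<open>u\<close> are
        tested.\<close>
      define s where "s = (\<lambda>_. 0)(K := vol L, L := - vol K)"
      have two: "(\<Sum>M\<in>T. vol M * s M * f M) = vol K * vol L * (f K - f L)" for f :: "'a set \<Rightarrow> real"
      proof -
        have "(\<Sum>M\<in>T. vol M * s M * f M) = (\<Sum>M\<in>{K, L}. vol M * s M * f M)"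
          using fin KL by (intro sum.mono_neutral_right) (auto simp: s_def)
        then show ?thesis using False by (simp add: s_def algebra_simps)
      qed
      have "(\<Sum>M\<in>T. vol M * s M) = 0" using two[of "\<lambda>_. 1"] by simp
      then have "(\<Sum>M\<in>T. vol M * s M * ln (u M)) = 0" using stat by blast
      then have "ln (u K) = ln (u L)" using two[of "\<lambda>M. ln (u M)"] vol[OF KL(1)] vol[OF KL(2)] by simp
      then show ?thesis using u KL by simp
    qed simp
    then show ?thesis by blast
  qed
  moreover have "(\<Sum>K\<in>T. vol K * s K * ln (u K)) = 0"
    if "\<forall>K\<in>T. u K = c" "(\<Sum>K\<in>T. vol K * s K) = 0" for c s
    using that by (simp flip: sum_distrib_right)
  ultimately show ?thesis using pos unfolding crit u_def[symmetric] by blast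
qed (auto simp: critical_point_def)

lemma kirkwood_monroe_iff:
  assumes \<rho>: "\<rho> \<in> mesh_prob T"
  shows "kirkwood_monroe \<kappa> W T x \<rho> \<longleftrightarrow>
    (\<exists>c. \<forall>K\<in>T. \<rho> K * exp (mesh_potential W T x \<rho> K / \<kappa>) = c)"
proof -
  define Z where "Z = partition_function \<kappa> W T x \<rho>"
  have gibbs: "gibbs_weight \<kappa> W T x \<rho> K = 1 / exp (mesh_potential W T x \<rho> K / \<kappa>)" for K
    by (simp add: gibbs_weight_def mesh_potential_def exp_minus divide_inverse mult_ac)
  have mass: "(\<Sum>K\<in>T. vol K * \<rho> K) = 1" using \<rho> by (simp add: mesh_prob_def)
  show ?thesis
  proof
    assume "kirkwood_monroe \<kappa> W T x \<rho>"
    then have "\<forall>K\<in>T. \<rho> K * exp (mesh_potential W T x \<rho> K / \<kappa>) = 1 / Z"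
      by (simp add: kirkwood_monroe_def gibbs Z_def)
    then show "\<exists>c. \<forall>K\<in>T. \<rho> K * exp (mesh_potential W T x \<rho> K / \<kappa>) = c" ..
  next
    assume "\<exists>c. \<forall>K\<in>T. \<rho> K * exp (mesh_potential W T x \<rho> K / \<kappa>) = c"
    then obtain c where c: "\<And>K. K \<in> T \<Longrightarrow> \<rho> K = c * gibbs_weight \<kappa> W T x \<rho> K"
      by (auto simp: gibbs field_simps)
    have "1 = (\<Sum>K\<in>T. vol K * (c * gibbs_weight \<kappa> W T x \<rho> K))"
      unfolding mass[symmetric] using c by (intro sum.cong) auto
    also have "\<dots> = c * Z" by (simp add: Z_def partition_function_def sum_distrib_left mult_ac)
    \<comment> \<open>The identity 1 = c Z itself excludes \<open>Z = 0\<close>.\<close>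
    finally have "c = 1 / Z" by (metis mult_zero_right nonzero_eq_divide_eq zero_neq_one)
    then show "kirkwood_monroe \<kappa> W T x \<rho>"
      using c by (simp add: kirkwood_monroe_def Z_def)
  qed
qed

text \<open>Supplies the positivity clause of \<open>critical_point\<close>, which the constancy of
  \<open>u\<close> does not state.\<close>

lemma kirkwood_monroe_pos:
  assumes fin: "finite T" and vol: "\<And>K. K \<in> T \<Longrightarrow> vol K > 0"
    and "kirkwood_monroe \<kappa> W T x \<rho>" "K \<in> T"
  shows "\<rho> K > 0"
proof -
  have "partition_function \<kappa> W T x \<rho> > 0"
    unfolding partition_function_def using assms by (intro sum_pos) (auto simp: gibbs_weight_def)
  then show ?thesis using assms(3,4) by (simp add: kirkwood_monroe_def gibbs_weight_def)
qed

section \<open>Constancy of functions along the connected neighbour graph\<close>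

lemma constant_if_neighbors_equal:
  assumes mesh: "voronoi_mesh \<Omega> h T x" and \<Omega>: "open \<Omega>" "connected \<Omega>"
    and eq: "\<And>K L. K \<in> T \<Longrightarrow> L \<in> neighbors T K \<Longrightarrow> u K = u L"
  shows "\<exists>c. \<forall>K\<in>T. u K = c"
proof (cases "T = {}")
  case False
  then obtain K where K: "K \<in> T" by blast
  \<comment> \<open>A nonempty level set that no edge leaves must be the whole mesh.\<close>
  have "{L \<in> T. u L = u K} = T"
    using mesh_graph_connected[OF mesh \<Omega>, of "{L \<in> T. u L = u K}"] eq K by fastforce
  then show ?thesis by blast
qed simp

text \<open>Discrete maximum principle for the weighted graph Laplacian.\<close>

lemma constant_if_harmonic:
  fixes u :: "'a::euclidean_space set \<Rightarrow> real"
  assumes mesh: "voronoi_mesh \<Omega> h T x" and \<Omega>: "open \<Omega>" "connected \<Omega>"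
    and w: "\<And>K L. K \<in> T \<Longrightarrow> L \<in> neighbors T K \<Longrightarrow> w K L > 0"
    and harm: "\<And>K. K \<in> T \<Longrightarrow> (\<Sum>L\<in>neighbors T K. w K L * (u K - u L)) = 0"
  shows "\<exists>c. \<forall>K\<in>T. u K = c"
proof (cases "T = {}")
  case False
  have fin: "finite T" using mesh_finite[OF mesh] .
  define m where "m = Max (u ` T)"
  have max: "u L \<le> m" if "L \<in> T" for L using fin that by (simp add: m_def)
  have "m \<in> u ` T" unfolding m_def using fin False by (intro Max_in) auto
  then have "{K \<in> T. u K = m} \<noteq> {}" by auto
  moreover have "u L = m" if K: "K \<in> T" "u K = m" and L: "L \<in> neighbors T K" for K L
  proof -
    have sub: "neighbors T K \<subseteq> T" by (auto simp: neighbors_def)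
    \<comment> \<open>At a maximiser all terms of the harmonic sum are nonnegative, so each vanishes
      and every neighbour attains the maximum too.\<close>
    have "0 \<le> w K L * (u K - u L)" if "L \<in> neighbors T K" for L
      using w[OF K(1) that] max[of L] sub that K(2) by auto
    then have "w K L * (u K - u L) = 0"
      using harm[OF K(1)] L sub fin by (metis (mono_tags, lifting) sum_nonneg_eq_0_iff finite_subset)
    then show ?thesis using w[OF K(1) L] K(2) by simp
  qed
  ultimately have "{K \<in> T. u K = m} = T"
    using mesh_graph_connected[OF mesh \<Omega>, of "{K \<in> T. u K = m}"] by blast
  then show ?thesis by blast
qed simp

section \<open>Equivalence of the four conditions through constancy of \<open>u\<close>\<close>

theorem theorem2:
  fixes \<Omega> :: "'a::euclidean_space set"
    and T :: "'a set set"
    and x :: "'a set \<Rightarrow> 'a"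
    and W :: "'a \<Rightarrow> real"
    and \<rho> :: "'a set \<Rightarrow> real"
    and h \<kappa> :: real
  assumes "bounded_smooth_domain \<Omega>"
    and "h > 0"
    and "voronoi_mesh \<Omega> h T x"
    and "\<kappa> > 0"
    and "\<And>z. W z = W (- z)"
    and "\<And>z. W z \<ge> 0"
    and "Ck_on 1 W (- {0})"
    and "\<exists>C. C-lipschitz_on UNIV W"
    and "\<rho> \<in> mesh_prob T"
  shows "(stationary_SG \<kappa> W T x \<rho> \<longleftrightarrow> kirkwood_monroe \<kappa> W T x \<rho>) \<and>
         (kirkwood_monroe \<kappa> W T x \<rho> \<longleftrightarrow> critical_point \<kappa> W T x \<rho>) \<and>
         (critical_point \<kappa> W T x \<rho> \<longleftrightarrow> dissipation \<kappa> W T x \<rho> = 0)"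
proof -
  note mesh = assms(3) and \<kappa> = assms(4)
  have \<Omega>: "open \<Omega>" "connected \<Omega>" using assms(1) by (auto simp: bounded_smooth_domain_def)
  note fin = mesh_finite[OF mesh] and vol = mesh_cell_vol_pos[OF mesh]
  have \<rho>: "\<rho> K \<ge> 0" if "K \<in> T" for K using assms(9) that by (simp add: mesh_prob_def)
  have fin_nb: "finite (neighbors T K)" for K using fin by (simp add: neighbors_def)
  have nb: "L \<in> T" "x K \<noteq> x L" if "K \<in> T" "L \<in> neighbors T K" for K L
    using that mesh_generator_inj[OF mesh] by (auto simp: neighbors_def)
  let ?\<phi> = "mesh_potential W T x \<rho>"
  let ?v = "\<lambda>K L. dist (x K) (x L) * drift W T x \<rho> K L"
  define u where "u K = \<rho> K * exp (?\<phi> K / \<kappa>)" for K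
  let ?const = "\<exists>c. \<forall>K\<in>T. u K = c"
  have KM: "kirkwood_monroe \<kappa> W T x \<rho> \<longleftrightarrow> ?const"
    unfolding u_def using kirkwood_monroe_iff[OF assms(9)] by blast
  \<comment> \<open>Constancy of \<open>u\<close> gives back the positivity of \<open>\<rho>\<close>
    by way of the Kirkwood--Monroe equation.\<close>
  have crit: "critical_point \<kappa> W T x \<rho> \<longleftrightarrow> ?const"
    using critical_point_iff[of T W \<kappa> x \<rho>] fin vol assms(5) \<kappa> KM kirkwood_monroe_pos[OF fin vol]
    unfolding u_def by blast
  have SG: "stationary_SG \<kappa> W T x \<rho> \<longleftrightarrow> ?const"
  proof -
    have "\<exists>g>0. theta \<kappa> (\<rho> K) (\<rho> L) (?\<phi> K - ?\<phi> L) = g * (u K - u L)" for K L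
      unfolding u_def using theta_factor[OF \<kappa>] by metis
    then obtain g where g: "\<And>K L. g K L > 0"
      "\<And>K L. theta \<kappa> (\<rho> K) (\<rho> L) (?\<phi> K - ?\<phi> L) = g K L * (u K - u L)"
      by metis
    have "stationary_SG \<kappa> W T x \<rho> \<longleftrightarrow>
        (\<forall>K\<in>T. (\<Sum>L\<in>neighbors T K. (transmission x K L * g K L) * (u K - u L)) = 0)"
      unfolding stationary_SG_def using nb
      by (intro ball_cong refl arg_cong[where f = "\<lambda>s. s = 0"] sum.cong)
        (auto simp: dist_times_drift g(2) mult.assoc)
    moreover have "?const" if "\<forall>K\<in>T. (\<Sum>L\<in>neighbors T K. (transmission x K L * g K L) * (u K - u L)) = 0"
      using that transmission_pos[OF mesh] g(1)
      by (intro constant_if_harmonic[OF mesh \<Omega>, of "\<lambda>K L. transmission x K L * g K L" u]) auto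
    moreover have "(\<Sum>L\<in>neighbors T K. (transmission x K L * g K L) * (u K - u L)) = 0"
      if "\<forall>K\<in>T. u K = c" "K \<in> T" for K c
      using that nb by (intro sum.neutral) auto
    ultimately show ?thesis by blast
  qed
  have diss: "dissipation \<kappa> W T x \<rho> = 0 \<longleftrightarrow> ?const"
  proof -
    let ?t = "\<lambda>K L. ereal (\<kappa> * transmission x K L) * alpha \<kappa> (\<rho> K) (\<rho> L) (?v K L)"
    \<comment> \<open>A positive finite factor preserves zero and nonzero values in
      \<open>ereal\<close>, including the infinite values of \<open>alpha\<close>. Nonnegativity
      then lets a vanishing sum be split into vanishing terms.\<close>
    have t: "0 \<le> ?t K L \<and> (?t K L = 0 \<longleftrightarrow> u K = u L)" if KL: "K \<in> T" "L \<in> neighbors T K" for K L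
    proof -
      have "0 \<le> alpha \<kappa> (\<rho> K) (\<rho> L) (?v K L) \<and> (alpha \<kappa> (\<rho> K) (\<rho> L) (?v K L) = 0 \<longleftrightarrow> u K = u L)"
        unfolding u_def using alpha_nonneg_zero_iff[OF \<kappa> \<rho> \<rho>] nb[OF KL] KL(1)
        by (simp add: dist_times_drift)
      moreover have "\<kappa> * transmission x K L > 0" using \<kappa> transmission_pos[OF mesh KL] by simp
      ultimately show ?thesis by (auto intro!: ereal_0_le_mult simp del: times_ereal.simps)
    qed
    have inner: "0 \<le> (\<Sum>L\<in>neighbors T K. ?t K L)" if "K \<in> T" for K
      using t[OF that] by (intro sum_nonneg) blast
    have "dissipation \<kappa> W T x \<rho> = 0 \<longleftrightarrow> (\<Sum>K\<in>T. \<Sum>L\<in>neighbors T K. ?t K L) = 0"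
      unfolding dissipation_def by (simp del: times_ereal.simps)
    also have "\<dots> \<longleftrightarrow> (\<forall>K\<in>T. (\<Sum>L\<in>neighbors T K. ?t K L) = 0)"
      using fin inner by (intro sum_nonneg_eq_0_iff) auto
    also have "\<dots> \<longleftrightarrow> (\<forall>K\<in>T. \<forall>L\<in>neighbors T K. ?t K L = 0)"
      using fin_nb t by (intro ball_cong refl sum_nonneg_eq_0_iff) blast+
    also have "\<dots> \<longleftrightarrow> (\<forall>K\<in>T. \<forall>L\<in>neighbors T K. u K = u L)" using t by blast
    also have "\<dots> \<longleftrightarrow> ?const"
    proof
      assume "\<forall>K\<in>T. \<forall>L\<in>neighbors T K. u K = u L"
      then show ?const by (intro constant_if_neighbors_equal[OF mesh \<Omega>]) blast
    next
      assume ?const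
      then show "\<forall>K\<in>T. \<forall>L\<in>neighbors T K. u K = u L" using nb(1) by metis
    qed
    finally show ?thesis .
  qed
  show ?thesis using SG KM crit diss by blast
qed

end
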